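(* For $n\ge1$ let $$\mathbb S(n,b,\hbar):=\sum_{\sigma\in\mathfrak S_n}\sigma\cdot\Bigg(\sum_{p=0}^n(-1)^p\binom np\prod_{i=1}^p(\lambda_i-b\hbar)\prod_{j=p+1}^n(\lambda_j+b\hbar)\prod_{1\le i<j\le n}\frac{\lambda_{ij}+\hbar}{\lambda_{ji}}\Bigg)\in\mathbb Q[b,\hbar](\lambda_1,\dots,\lambda_n)^{\mathfrak S_n},$$ where $\lambda_{ij}=\lambda_i-\lambda_j$. (1) The element $\mathbb S(n,b,\hbar)$ lies in $\mathbb Q[b,\hbar]$; that is, it does not depend on the variables $\lambda_1,\dots,\lambda_n$. (2) $\mathbb S(1,b,\hbar)=2\hbar b$, and one has the recursive formula $$\mathbb S(n,b,\hbar)=\mathbb S(n-1,b,\hbar)\cdot\Big((-1)^{n+1}2\hbar n\big(b-\tfrac{n-1}2\big)\Big)\qquad(n\ge2).$$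
   Context: $\lambda_1,\dots,\lambda_n,b,\hbar$ are independent commuting variables; $\mathfrak S_n$ acts on rational functions by permuting $\lambda_1,\dots,\lambda_n$. *)

theory Defs
  imports
    Complex_Main
    "HOL-Library.Poly_Mapping"
    "HOL-Computational_Algebra.Polynomial"
    "HOL-Computational_Algebra.Fraction_Field"
    "HOL-Combinatorics.Permutations"
begin

text \<open>
  The type \<open>bh_poly\<close> is the ring \<open>\<rat>[b,\<hbar>]\<close>: \<open>b\<close> is the variable of the inner polynomials and
  \<open>\<hbar>\<close> that of the outer ones. The type \<open>lam_poly\<close> is the polynomial ring over it in variables
  \<open>\<lambda>\<^sub>0, \<lambda>\<^sub>1, \<lambda>\<^sub>2, \<dots>\<close> (monomials are finitely supported exponent functions), and \<open>lam_frac\<close> is its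
  field of fractions. It contains the rational functions in \<open>\<lambda>\<^sub>1, \<dots>, \<lambda>\<^sub>n\<close> for every \<open>n\<close> at once,
  so that the elements \<open>S(n,b,\<hbar>)\<close> for different \<open>n\<close> can be compared.
\<close>

type_synonym bh_poly = "rat poly poly"
type_synonym lam_poly = "(nat \<Rightarrow>\<^sub>0 nat) \<Rightarrow>\<^sub>0 bh_poly"
type_synonym lam_frac = "lam_poly fract"

definition bh_const :: "bh_poly \<Rightarrow> lam_frac" where
  "bh_const c = Fract (Poly_Mapping.single 0 c) 1"

definition bvar :: lam_frac where
  "bvar = bh_const [:[:0, 1:]:]"

definition hbar :: lam_frac where
  "hbar = bh_const [:0, 1:]"

definition lam :: "nat \<Rightarrow> lam_frac" where
  "lam i = Fract (Poly_Mapping.single (Poly_Mapping.single i 1) 1) 1"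

definition bh_ring :: "lam_frac set" where
  "bh_ring = range bh_const"

text \<open>
  The action on polynomials is given on coefficients: the coefficient of the monomial \<open>m\<close> in
  \<open>\<sigma>\<cdot>P\<close> is that of \<open>m \<circ> \<sigma>\<close> in \<open>P\<close>, so that \<open>\<sigma>\<cdot>\<lambda>\<^sub>i = \<lambda>\<^bsub>\<sigma>(i)\<^esub>\<close>. Here and below \<open>\<sigma>\<close> is meant to be
  a bijection.
\<close>

definition perm_poly :: "(nat \<Rightarrow> nat) \<Rightarrow> lam_poly \<Rightarrow> lam_poly" where
  "perm_poly \<sigma> P = Poly_Mapping.map_key (Poly_Mapping.map_key \<sigma>) P"

lemma bij_map_key:
  fixes \<sigma> :: "'a \<Rightarrow> 'a"
  assumes "bij \<sigma>"
  shows "bij (Poly_Mapping.map_key \<sigma> :: ('a \<Rightarrow>\<^sub>0 'b::zero) \<Rightarrow> _)"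
proof (rule o_bij)
  have i: "inj \<sigma>" "inj (inv \<sigma>)"
    using assms by (auto simp: bij_is_inj bij_imp_bij_inv)
  show "Poly_Mapping.map_key (inv \<sigma>) \<circ> Poly_Mapping.map_key \<sigma> = (id :: ('a \<Rightarrow>\<^sub>0 'b) \<Rightarrow> _)"
    using assms i by (auto simp: fun_eq_iff map_key_compose map_key_id o_def bij_is_surj surj_f_inv_f)
  show "Poly_Mapping.map_key \<sigma> \<circ> Poly_Mapping.map_key (inv \<sigma>) = (id :: ('a \<Rightarrow>\<^sub>0 'b) \<Rightarrow> _)"
    using assms i by (auto simp: fun_eq_iff map_key_compose map_key_id o_def)
qed

lemma lookup_perm_poly:
  "bij \<sigma> \<Longrightarrow> Poly_Mapping.lookup (perm_poly \<sigma> P) m = Poly_Mapping.lookup P (Poly_Mapping.map_key \<sigma> m)"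
  unfolding perm_poly_def by (simp add: bij_is_inj bij_map_key map_key.rep_eq)

lemma perm_poly_0 [simp]: "bij \<sigma> \<Longrightarrow> perm_poly \<sigma> 0 = 0"
  by (rule poly_mapping_eqI) (simp add: lookup_perm_poly)

lemma perm_poly_eq_0_iff [simp]:
  assumes "bij \<sigma>"
  shows "perm_poly \<sigma> P = 0 \<longleftrightarrow> P = 0"
proof
  assume z: "perm_poly \<sigma> P = 0"
  show "P = 0"
  proof (rule poly_mapping_eqI)
    fix m :: "nat \<Rightarrow>\<^sub>0 nat"
    obtain k where "m = Poly_Mapping.map_key \<sigma> k"
      using bij_map_key[OF assms] by (metis bij_pointE)
    then show "Poly_Mapping.lookup P m = Poly_Mapping.lookup 0 m"
      using lookup_perm_poly[OF assms, of P k] z by simp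
  qed
qed (use assms in simp)

lemma perm_poly_add:
  "bij \<sigma> \<Longrightarrow> perm_poly \<sigma> (P + Q) = perm_poly \<sigma> P + perm_poly \<sigma> Q"
  by (rule poly_mapping_eqI) (simp add: lookup_perm_poly lookup_add)

lemma perm_poly_single:
  assumes "bij \<sigma>"
  shows "perm_poly \<sigma> (Poly_Mapping.single (Poly_Mapping.map_key \<sigma> m) c) = Poly_Mapping.single m c"
  unfolding perm_poly_def by (rule map_key_single) (simp add: bij_is_inj bij_map_key assms)

lemma perm_poly_mult_single:
  assumes "bij \<sigma>"
  shows "perm_poly \<sigma> (Poly_Mapping.single k c * Poly_Mapping.single l d) =
    perm_poly \<sigma> (Poly_Mapping.single k c) * perm_poly \<sigma> (Poly_Mapping.single l d)"
proof -
  obtain k' l' where [simp]: "k = Poly_Mapping.map_key \<sigma> k'" "l = Poly_Mapping.map_key \<sigma> l'"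
    using bij_map_key[OF assms] by (metis bij_pointE)
  show ?thesis
    using assms
    by (simp add: mult_single perm_poly_single bij_is_inj flip: map_key_plus)
qed

lemma update_eq_add_single:
  "k \<notin> Poly_Mapping.keys f \<Longrightarrow> Poly_Mapping.update k v f = f + Poly_Mapping.single k v"
  by (rule poly_mapping_eqI) (auto simp: lookup_update lookup_add lookup_single in_keys_iff when_def)

lemma perm_poly_mult:
  assumes "bij \<sigma>"
  shows "perm_poly \<sigma> (P * Q) = perm_poly \<sigma> P * perm_poly \<sigma> Q"
proof -
  have s: "perm_poly \<sigma> (Poly_Mapping.single k c * Q)
    = perm_poly \<sigma> (Poly_Mapping.single k c) * perm_poly \<sigma> Q" for k c
    by (induction Q rule: update_induct)
      (simp_all add: assms update_eq_add_single perm_poly_add distrib_left perm_poly_mult_single)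
  show ?thesis
    by (induction P rule: update_induct)
      (simp_all add: assms update_eq_add_single perm_poly_add distrib_right s)
qed

text \<open>The guard only serves to make the function well defined on fractions for every \<open>\<sigma>\<close>.\<close>

lift_definition perm_frac :: "(nat \<Rightarrow> nat) \<Rightarrow> lam_frac \<Rightarrow> lam_frac" is
  "\<lambda>\<sigma> (P, Q). if bij \<sigma> then (perm_poly \<sigma> P, perm_poly \<sigma> Q) else (P, Q)"
  by (auto split: if_splits simp flip: perm_poly_mult)

lemma perm_poly_1 [simp]:
  assumes "bij \<sigma>"
  shows "perm_poly \<sigma> 1 = 1"
  using perm_poly_single[OF assms, of 0 1] assms by (simp add: bij_is_inj)

lemma perm_frac_Fract:
  "bij \<sigma> \<Longrightarrow> perm_frac \<sigma> (Fract P Q) = Fract (perm_poly \<sigma> P) (perm_poly \<sigma> Q)"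
  by transfer auto

lemma perm_frac_add: "bij \<sigma> \<Longrightarrow> perm_frac \<sigma> (x + y) = perm_frac \<sigma> x + perm_frac \<sigma> y"
  by (cases x; cases y) (simp add: perm_frac_Fract perm_poly_add perm_poly_mult)

lemma perm_frac_mult: "bij \<sigma> \<Longrightarrow> perm_frac \<sigma> (x * y) = perm_frac \<sigma> x * perm_frac \<sigma> y"
  by (cases x; cases y) (simp add: perm_frac_Fract perm_poly_mult)

lemma perm_frac_bh_const [simp]:
  assumes "bij \<sigma>"
  shows "perm_frac \<sigma> (bh_const c) = bh_const c"
  using perm_poly_single[OF assms, of 0 c] assms
  by (simp add: bh_const_def perm_frac_Fract bij_is_inj)

lemma perm_frac_lam [simp]:
  assumes "bij \<sigma>"
  shows "perm_frac \<sigma> (lam i) = lam (\<sigma> i)"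
proof -
  have "Poly_Mapping.map_key \<sigma> (Poly_Mapping.single (\<sigma> i) (1::nat)) = Poly_Mapping.single i 1"
    by (rule map_key_single) (simp add: assms bij_is_inj)
  then show ?thesis
    using perm_poly_single[OF assms, of "Poly_Mapping.single (\<sigma> i) 1" 1] assms
    by (simp add: lam_def perm_frac_Fract)
qed

definition S_sum :: "nat \<Rightarrow> lam_frac" where
  "S_sum n =
    (\<Sum>\<sigma> | \<sigma> permutes {1..n}. perm_frac \<sigma>
      (\<Sum>p=0..n. (-1) ^ p * of_nat (n choose p) *
        (\<Prod>i=1..p. lam i - bvar * hbar) *
        (\<Prod>j=p+1..n. lam j + bvar * hbar) *
        (\<Prod>(i, j) \<in> {(i, j). 1 \<le> i \<and> i < j \<and> j \<le> n}. (lam i - lam j + hbar) / (lam j - lam i))))"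

end

theory Submission
  imports Defs "Jordan_Normal_Form.Determinant" "HOL-Combinatorics.Multiset_Permutations"
begin

text \<open>
  Write \<open>\<beta> = b\<hbar>\<close> and \<open>r(a,c) = (a - c + \<hbar>)/(a - c)\<close>. Both parts of the theorem follow from the closed
  form
  \[ S(n,b,\<hbar>) = (-1)^{n(n-1)/2} \, n! \, \prod_{k<n} (2\<beta> - k\<hbar>) \]
  (\<open>S_sum_eq\<close>). The sign comes from writing the factor of each pair \<open>i < j\<close> as
  \<open>- r(\<lambda>\<^sub>i, \<lambda>\<^sub>j)\<close>. There are two steps.

  From permutations to subsets. For fixed \<open>p\<close>, the polynomial factors of the summand of a
  permutation \<open>\<sigma>\<close> depend only on the set \<open>I\<close> of the first \<open>p\<close> variables. Lagrange interpolation gives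
  \<open>\<Sum>\<^sub>a \<Prod>\<^bsub>c \<noteq> a\<^esub> r(a,c) = m\<close> for \<open>a, c\<close> ranging over any \<open>m\<close> elements (\<open>sum_shift_ratios\<close>), and so
  summing over the orders within \<open>I\<close> and within its complement yields just \<open>p! (n-p)!\<close>
  (\<open>sum_ord_weight\<close>). This cancels the binomial coefficient up to \<open>n!\<close>, and leaves
  \[ \sum_I \prod_{a \in I} -(a - \<beta>) \prod_{a \notin I} (a + \<beta>) \prod_{a \in I, c \notin I} r(a,c). \]

  From subsets to a determinant. The last product is the quotient of two Vandermonde products, the
  numerator being that of the variables after the shift of those in \<open>I\<close> by \<open>\<hbar>\<close>
  (\<open>vandermonde_shift\<close>). Since a determinant is additive in each row, the sum over \<open>I\<close> times the
  Vandermonde product is the determinant of the matrix \<open>(P\<^sub>j(\<lambda>\<^sub>i))\<close> with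
  \[ P_j(X) = (X + \<beta>) X^j - (X - \<beta>) (X + \<hbar>)^j. \]
  The terms of degree \<open>j + 1\<close> cancel, and \<open>P\<^sub>j\<close> has degree at most \<open>j\<close> with coefficient \<open>2\<beta> - j\<hbar>\<close> at
  \<open>X\<^sup>j\<close>. Thus column operations turn the matrix into the Vandermonde matrix with columns scaled by
  these coefficients, which gives the product (\<open>subset_sum_eval\<close>).
\<close>

section \<open>Determinants of polynomial values and the Vandermonde product\<close>

text \<open>
  The matrix of values is the Vandermonde matrix times the matrix of coefficients, which is upper
  triangular.
\<close>

lemma det_poly_values:
  fixes y :: "nat \<Rightarrow> 'a :: idom"
  assumes deg: "\<And>j. j < n \<Longrightarrow> degree (P j) \<le> j"
  shows "det (mat n n (\<lambda>(i, j). poly (P j) (y i))) =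
    (\<Prod>j<n. coeff (P j) j) * det (mat n n (\<lambda>(i, j). y i ^ j))"
proof -
  let ?V = "mat n n (\<lambda>(i, j). y i ^ j)" and ?C = "mat n n (\<lambda>(k, j). coeff (P j) k)"
  have "mat n n (\<lambda>(i, j). poly (P j) (y i)) = ?V * ?C"
  proof (rule eq_matI)
    fix i j assume "i < dim_row (?V * ?C)" "j < dim_col (?V * ?C)"
    then have ij: "i < n" "j < n" by auto
    have "poly (P j) (y i) = (\<Sum>k\<le>degree (P j). coeff (P j) k * y i ^ k)"
      by (rule poly_altdef)
    also have "\<dots> = (\<Sum>k\<in>{0..<n}. coeff (P j) k * y i ^ k)"
      using deg[OF ij(2)] ij by (intro sum.mono_neutral_left) (auto simp: coeff_eq_0)
    finally show "mat n n (\<lambda>(i, j). poly (P j) (y i)) $$ (i, j) = (?V * ?C) $$ (i, j)"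
      using ij by (simp add: scalar_prod_def mult.commute)
  qed auto
  moreover have "det ?C = (\<Prod>j<n. coeff (P j) j)"
  proof -
    have "upper_triangular ?C"
      by (auto intro!: upper_triangularI coeff_eq_0 le_less_trans[OF deg])
    then have "det ?C = prod_list (diag_mat ?C)"
      by (rule det_upper_triangular[where n = n]) simp
    also have "\<dots> = (\<Prod>j<n. coeff (P j) j)"
      by (simp add: prod_list_diag_prod atLeast0LessThan)
    finally show ?thesis .
  qed
  moreover have "det (?V * ?C) = det ?V * det ?C"
    by (rule det_mult[where n = n]) auto
  ultimately show ?thesis by (simp add: mult.commute)
qed

text \<open>
  Replacing the monomials by the monic Newton polynomials \<open>\<Prod>\<^bsub>k<j\<^esub> (X - y\<^sub>k)\<close> leaves the determinant
  unchanged, and their values at the \<open>y\<^sub>i\<close> form a lower triangular matrix.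
\<close>

lemma det_vandermonde:
  fixes y :: "nat \<Rightarrow> 'a :: idom"
  shows "det (mat n n (\<lambda>(i, j). y i ^ j)) = (\<Prod>j<n. \<Prod>i<j. y j - y i)"
proof -
  define N where "N j = (\<Prod>k<j. [:- y k, 1:])" for j
  have lead: "degree (N j) = j" "coeff (N j) j = 1" for j
  proof -
    show d: "degree (N j) = j" unfolding N_def by (subst degree_prod_eq_sum_degree) auto
    have "lead_coeff (N j) = 1" unfolding N_def by (simp add: lead_coeff_prod)
    then show "coeff (N j) j = 1" by (simp add: d)
  qed
  have val: "poly (N j) (y i) = (\<Prod>k<j. y i - y k)" for i j
    by (simp add: N_def poly_prod)
  have "det (mat n n (\<lambda>(i, j). y i ^ j)) = det (mat n n (\<lambda>(i, j). poly (N j) (y i)))"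
    by (subst det_poly_values) (auto simp: lead)
  also have "\<dots> = prod_list (diag_mat (mat n n (\<lambda>(i, j). poly (N j) (y i))))"
    by (rule det_lower_triangular[where n = n]) (auto simp: val)
  also have "\<dots> = (\<Prod>j<n. \<Prod>i<j. y j - y i)"
    by (simp add: prod_list_diag_prod atLeast0LessThan val)
  finally show ?thesis .
qed

section \<open>The sum over subsets\<close>

lemma prod_triangle_swap:
  fixes F :: "nat \<Rightarrow> nat \<Rightarrow> 'a :: comm_monoid_mult"
  shows "(\<Prod>j<n. \<Prod>i<j. F i j) = (\<Prod>i<n. \<Prod>j\<in>{i<..<n}. F i j)"
proof -
  have "(\<Prod>j<n. \<Prod>i<j. F i j) = (\<Prod>(j, i)\<in>(SIGMA j:{..<n}. {..<j}). F i j)"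
    by (rule prod.Sigma) auto
  also have "\<dots> = (\<Prod>(i, j)\<in>(SIGMA i:{..<n}. {i<..<n}). F i j)"
    by (rule prod.reindex_bij_witness[of _ prod.swap prod.swap]) auto
  also have "\<dots> = (\<Prod>i<n. \<Prod>j\<in>{i<..<n}. F i j)"
    by (rule prod.Sigma[symmetric]) auto
  finally show ?thesis .
qed

text \<open>
  A difference changes only if exactly one of its two variables is shifted. If \<open>y\<^sub>i\<close> is shifted and
  \<open>y\<^sub>j\<close> is not, then it is multiplied by \<open>(y\<^sub>i - y\<^sub>j + h)/(y\<^sub>i - y\<^sub>j)\<close>, whichever of the indices is larger.
\<close>

lemma vandermonde_shift:
  fixes y :: "nat \<Rightarrow> 'a :: field"
  assumes inj: "inj_on y {..<n}" and J: "J \<subseteq> {..<n}"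
  shows "(\<Prod>j<n. \<Prod>i<j. (if j \<in> J then y j + h else y j) - (if i \<in> J then y i + h else y i)) =
    (\<Prod>i\<in>J. \<Prod>j\<in>{..<n} - J. (y i - y j + h) / (y i - y j)) * (\<Prod>j<n. \<Prod>i<j. y j - y i)"
proof -
  define c where "c i j = (if i \<in> J \<and> j \<notin> J then (y i - y j + h) / (y i - y j) else 1)" for i j
  have "(\<Prod>i\<in>J. \<Prod>j\<in>{..<n} - J. (y i - y j + h) / (y i - y j)) =
      (\<Prod>i<n. if i \<in> J then \<Prod>j\<in>{..<n} - J. (y i - y j + h) / (y i - y j) else 1)"
    using J by (simp add: prod.If_cases Int_absorb1)
  also have "\<dots> = (\<Prod>i<n. \<Prod>j<n. c i j)"
  proof (rule prod.cong[OF refl])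
    fix i assume "i \<in> {..<n}"
    show "(if i \<in> J then \<Prod>j\<in>{..<n} - J. (y i - y j + h) / (y i - y j) else 1) = (\<Prod>j<n. c i j)"
      by (cases "i \<in> J") (auto simp: c_def prod.If_cases Diff_eq intro!: prod.cong)
  qed
  also have "\<dots> = (\<Prod>i<n. (\<Prod>j<i. c i j) * (\<Prod>j\<in>{i<..<n}. c i j))"
  proof (rule prod.cong[OF refl])
    fix i assume i: "i \<in> {..<n}"
    then have "{..<n} = {..<i} \<union> insert i {i<..<n}" by auto
    moreover have "(\<Prod>j\<in>{..<i} \<union> insert i {i<..<n}. c i j) =
        (\<Prod>j<i. c i j) * (\<Prod>j\<in>insert i {i<..<n}. c i j)"
      by (rule prod.union_disjoint) auto
    ultimately have "(\<Prod>j<n. c i j) = (\<Prod>j<i. c i j) * (\<Prod>j\<in>insert i {i<..<n}. c i j)"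
      by (rule ssubst)
    then show "(\<Prod>j<n. c i j) = (\<Prod>j<i. c i j) * (\<Prod>j\<in>{i<..<n}. c i j)"
      by (simp add: c_def)
  qed
  also have "\<dots> = (\<Prod>j<n. \<Prod>i<j. c j i * c i j)"
    by (simp add: prod.distrib prod_triangle_swap[of "\<lambda>i j. c i j"])
  finally have "(\<Prod>i\<in>J. \<Prod>j\<in>{..<n} - J. (y i - y j + h) / (y i - y j)) * (\<Prod>j<n. \<Prod>i<j. y j - y i)
      = (\<Prod>j<n. \<Prod>i<j. c j i * c i j * (y j - y i))"
    by (simp add: prod.distrib)
  also have "\<dots> = (\<Prod>j<n. \<Prod>i<j.
      (if j \<in> J then y j + h else y j) - (if i \<in> J then y i + h else y i))"
  proof (intro prod.cong refl)
    fix j i assume "j \<in> {..<n}" "i \<in> {..<j}"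
    then have "y j - y i \<noteq> 0" "y i - y j \<noteq> 0" using inj by (auto dest: inj_onD)
    then show "c j i * c i j * (y j - y i) =
        (if j \<in> J then y j + h else y j) - (if i \<in> J then y i + h else y i)"
      by (auto simp: c_def divide_simps) (auto simp: algebra_simps)
  qed
  finally show ?thesis by simp
qed

lemma permutes_lt: "p permutes {..<n} \<Longrightarrow> i < n \<Longrightarrow> p i < (n :: nat)"
  using permutes_in_image[of p "{..<n}" i] by simp

text \<open>
  Expanding each row of the determinant into its two summands chooses the set \<open>J\<close> of rows that
  contribute the shifted powers. What remains for \<open>J\<close> is a Vandermonde determinant in partly shifted
  variables.
\<close>

lemma subset_sum_det:
  fixes y :: "nat \<Rightarrow> 'a :: field"
  assumes inj: "inj_on y {..<n}"
  shows "(\<Sum>J\<in>Pow {..<n}. (\<Prod>i\<in>J. f (y i)) * (\<Prod>i\<in>{..<n} - J. g (y i)) *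
      (\<Prod>i\<in>J. \<Prod>j\<in>{..<n} - J. (y i - y j + h) / (y i - y j))) * (\<Prod>j<n. \<Prod>i<j. y j - y i) =
    det (mat n n (\<lambda>(i, j). f (y i) * (y i + h) ^ j + g (y i) * y i ^ j))"
proof -
  let ?y = "\<lambda>J i. if i \<in> J then y i + h else y i"
  have "det (mat n n (\<lambda>(i, j). f (y i) * (y i + h) ^ j + g (y i) * y i ^ j)) =
      (\<Sum>p | p permutes {..<n}. signof p *
        (\<Prod>i<n. f (y i) * (y i + h) ^ p i + g (y i) * y i ^ p i))"
    by (subst det_def'[where n = n])
      (auto simp: atLeast0LessThan permutes_lt intro!: sum.cong prod.cong)
  also have "\<dots> = (\<Sum>p | p permutes {..<n}. \<Sum>J\<in>Pow {..<n}. signof p *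
      ((\<Prod>i\<in>J. f (y i) * (y i + h) ^ p i) * (\<Prod>i\<in>{..<n} - J. g (y i) * y i ^ p i)))"
    by (simp add: prod_add sum_distrib_left)
  also have "\<dots> = (\<Sum>J\<in>Pow {..<n}. \<Sum>p | p permutes {..<n}. signof p *
      ((\<Prod>i\<in>J. f (y i) * (y i + h) ^ p i) * (\<Prod>i\<in>{..<n} - J. g (y i) * y i ^ p i)))"
    by (rule sum.swap)
  also have "\<dots> = (\<Sum>J\<in>Pow {..<n}. (\<Prod>i\<in>J. f (y i)) * (\<Prod>i\<in>{..<n} - J. g (y i)) *
      (\<Sum>p | p permutes {..<n}. signof p * (\<Prod>i<n. ?y J i ^ p i)))"
  proof (rule sum.cong[OF refl])
    fix J assume "J \<in> Pow {..<n}"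
    then have J: "J \<subseteq> {..<n}" by simp
    have "(\<Prod>i<n. ?y J i ^ p i) = (\<Prod>i\<in>J. (y i + h) ^ p i) * (\<Prod>i\<in>{..<n} - J. y i ^ p i)" for p
      by (subst prod.subset_diff[OF J]) (auto simp: mult.commute intro!: arg_cong2[of _ _ _ _ "(*)"] prod.cong)
    then show "(\<Sum>p | p permutes {..<n}. signof p *
        ((\<Prod>i\<in>J. f (y i) * (y i + h) ^ p i) * (\<Prod>i\<in>{..<n} - J. g (y i) * y i ^ p i))) =
      (\<Prod>i\<in>J. f (y i)) * (\<Prod>i\<in>{..<n} - J. g (y i)) *
      (\<Sum>p | p permutes {..<n}. signof p * (\<Prod>i<n. ?y J i ^ p i))"
      by (simp add: prod.distrib sum_distrib_left mult_ac)
  qed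
  also have "\<dots> = (\<Sum>J\<in>Pow {..<n}. (\<Prod>i\<in>J. f (y i)) * (\<Prod>i\<in>{..<n} - J. g (y i)) *
      (\<Prod>j<n. \<Prod>i<j. ?y J j - ?y J i))"
  proof -
    have "(\<Sum>p | p permutes {..<n}. signof p * (\<Prod>i<n. ?y J i ^ p i)) =
        det (mat n n (\<lambda>(i, j). ?y J i ^ j))" for J
      by (subst det_def'[where n = n])
        (auto simp: atLeast0LessThan permutes_lt intro!: sum.cong prod.cong)
    then show ?thesis by (simp only: det_vandermonde)
  qed
  also have "\<dots> = (\<Sum>J\<in>Pow {..<n}. (\<Prod>i\<in>J. f (y i)) * (\<Prod>i\<in>{..<n} - J. g (y i)) *
      (\<Prod>i\<in>J. \<Prod>j\<in>{..<n} - J. (y i - y j + h) / (y i - y j))) * (\<Prod>j<n. \<Prod>i<j. y j - y i)"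
    by (simp add: vandermonde_shift[OF inj] sum_distrib_right mult.assoc)
  finally show ?thesis by simp
qed

lemma subset_sum_eval:
  fixes A :: "'a :: field set"
  assumes fin: "finite A"
  shows "(\<Sum>I\<in>Pow A. (\<Prod>a\<in>I. - (a - \<beta>)) * (\<Prod>a\<in>A - I. a + \<beta>) *
      (\<Prod>a\<in>I. \<Prod>c\<in>A - I. (a - c + h) / (a - c))) = (\<Prod>k<card A. 2 * \<beta> - of_nat k * h)"
proof -
  define n where "n = card A"
  obtain y where y: "bij_betw y {..<n} A"
    using fin ex_bij_betw_nat_finite[OF fin] by (auto simp: n_def atLeast0LessThan)
  then have inj: "inj_on y {..<n}" and im: "A = y ` {..<n}" by (auto simp: bij_betw_def)
  define P where "P j = [:\<beta>, -1:] * [:h, 1:] ^ j + [:\<beta>, 1:] * monom 1 j" for j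
  have cP: "coeff (P j) j = 2 * \<beta> - of_nat j * h" and dP: "degree (P j) \<le> j" for j
  proof -
    have d: "degree ([:h, 1:] ^ j) = j" by (simp add: degree_power_eq)
    have l: "coeff ([:h, 1:] ^ j) j = 1" using lead_coeff_power[of "[:h, 1:]" j] d by simp
    (* The subleading coefficient of (X + h)^(k+1): it accounts for the term - j h of cP. *)
    have s: "coeff ([:h, 1:] ^ Suc k) k = of_nat (Suc k) * h" for k
    proof (induction k)
      case (Suc k)
      have "degree ([:h, 1:] ^ Suc k) = Suc k" by (rule trans[OF degree_power_eq]) auto
      then have "coeff ([:h, 1:] ^ Suc k) (Suc k) = 1"
        using lead_coeff_power[of "[:h, 1:]" "Suc k"] by simp
      then show ?case using Suc by (simp del: power_Suc add: power_Suc[of _ "Suc k"] algebra_simps)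
    qed simp
    show "coeff (P j) j = 2 * \<beta> - of_nat j * h"
      using l s[of "j - 1"] by (cases j) (auto simp: P_def coeff_pCons algebra_simps simp del: power_Suc)
    have "coeff (P j) m = 0" if "j < m" for m
    proof (cases "m = Suc j")
      case True then show ?thesis using l by (simp add: P_def d coeff_eq_0)
    next
      case False then show ?thesis using that d
        by (cases m) (auto simp: P_def coeff_eq_0)
    qed
    then show "degree (P j) \<le> j" by (intro degree_le) auto
  qed
  have nz: "(\<Prod>j<n. \<Prod>i<j. y j - y i) \<noteq> 0"
    using inj by (auto dest: inj_onD)
  have img: "(\<Prod>a\<in>y ` J. F a) = (\<Prod>i\<in>J. F (y i))" if "J \<subseteq> {..<n}" for J and F :: "'a \<Rightarrow> 'a"
    using that inj by (subst prod.reindex) (auto intro: inj_on_subset)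
  have "(\<Sum>I\<in>Pow A. (\<Prod>a\<in>I. - (a - \<beta>)) * (\<Prod>a\<in>A - I. a + \<beta>) *
      (\<Prod>a\<in>I. \<Prod>c\<in>A - I. (a - c + h) / (a - c))) =
    (\<Sum>J\<in>Pow {..<n}. (\<Prod>i\<in>J. - (y i - \<beta>)) * (\<Prod>i\<in>{..<n} - J. y i + \<beta>) *
      (\<Prod>i\<in>J. \<Prod>j\<in>{..<n} - J. (y i - y j + h) / (y i - y j)))"
  proof (rule sum.reindex_cong)
    show "inj_on ((`) y) (Pow {..<n})" by (rule inj_on_image_Pow[OF inj])
    show "Pow A = (`) y ` Pow {..<n}" by (simp add: im image_Pow_surj)
    fix J assume "J \<in> Pow {..<n}"
    then have J: "J \<subseteq> {..<n}" by simp
    then have "A - y ` J = y ` ({..<n} - J)" using inj by (simp add: im inj_on_image_set_diff)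
    then show "(\<Prod>a\<in>y ` J. - (a - \<beta>)) * (\<Prod>a\<in>A - y ` J. a + \<beta>) *
        (\<Prod>a\<in>y ` J. \<Prod>c\<in>A - y ` J. (a - c + h) / (a - c)) =
      (\<Prod>i\<in>J. - (y i - \<beta>)) * (\<Prod>i\<in>{..<n} - J. y i + \<beta>) *
        (\<Prod>i\<in>J. \<Prod>j\<in>{..<n} - J. (y i - y j + h) / (y i - y j))"
      using J by (simp add: img)
  qed
  moreover have "\<dots> * (\<Prod>j<n. \<Prod>i<j. y j - y i) = det (mat n n (\<lambda>(i, j). poly (P j) (y i)))"
    unfolding subset_sum_det[OF inj, of "\<lambda>a. - (a - \<beta>)" "\<lambda>a. a + \<beta>"]
    by (simp add: P_def poly_monom algebra_simps)
  moreover have "\<dots> = (\<Prod>j<n. 2 * \<beta> - of_nat j * h) * (\<Prod>j<n. \<Prod>i<j. y j - y i)"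
    by (subst det_poly_values) (auto simp: dP cP det_vandermonde)
  ultimately show ?thesis using nz by (simp add: n_def)
qed

section \<open>Lagrange interpolation\<close>

text \<open>
  Compare the leading coefficients in Lagrange's interpolation formula for \<open>q\<close> at the points of \<open>A\<close>.
\<close>

lemma sum_lagrange_quotients:
  fixes q :: "'a :: field poly"
  assumes fin: "finite A" and deg: "degree q < card A"
  shows "(\<Sum>a\<in>A. poly q a / (\<Prod>c\<in>A - {a}. a - c)) = coeff q (card A - 1)"
proof -
  define N where "N a = (\<Prod>c\<in>A - {a}. [:- c, 1:])" for a
  define L where "L = (\<Sum>a\<in>A. Polynomial.smult (poly q a / (\<Prod>c\<in>A - {a}. a - c)) (N a))"
  have N: "degree (N a) = card A - 1" "coeff (N a) (card A - 1) = 1" if "a \<in> A" for a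
  proof -
    show d: "degree (N a) = card A - 1"
      using that fin unfolding N_def by (subst degree_prod_eq_sum_degree) auto
    have "lead_coeff (N a) = 1" unfolding N_def by (simp add: lead_coeff_prod)
    then show "coeff (N a) (card A - 1) = 1" by (simp add: d)
  qed
  have "degree L \<le> card A - 1"
    unfolding L_def by (intro degree_sum_le) (use fin in \<open>auto intro: order.trans[OF degree_smult_le] simp: N\<close>)
  then have "degree L < card A" using deg by linarith
  moreover have "poly q x = poly L x" if x: "x \<in> A" for x
  proof -
    have "poly L x = (\<Sum>a\<in>A. poly q a / (\<Prod>c\<in>A - {a}. a - c) * (\<Prod>c\<in>A - {a}. x - c))"
      by (simp add: L_def N_def poly_sum poly_prod)
    also have "\<dots> = (\<Sum>a\<in>A. if a = x then poly q x else 0)"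
    proof (rule sum.cong[OF refl])
      fix a assume "a \<in> A"
      show "poly q a / (\<Prod>c\<in>A - {a}. a - c) * (\<Prod>c\<in>A - {a}. x - c) = (if a = x then poly q x else 0)"
      proof (cases "a = x")
        case True
        then show ?thesis using fin by auto
      next
        case False
        then have "(\<Prod>c\<in>A - {a}. x - c) = 0" using x fin by (intro prod_zero) auto
        then show ?thesis using False by simp
      qed
    qed
    also have "\<dots> = poly q x" using fin x by simp
    finally show ?thesis by simp
  qed
  ultimately have "q = L" by (intro poly_eqI_degree[of A]) (use deg in auto)
  then have "coeff q (card A - 1) = coeff L (card A - 1)" by simp
  then show ?thesis by (simp add: L_def coeff_sum N del: One_nat_def)
qed

lemma coeff_prod_linear_pred_card:
  fixes s :: "'b \<Rightarrow> 'a :: idom"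
  assumes "finite A" "A \<noteq> {}"
  shows "coeff (\<Prod>c\<in>A. [:s c, 1:]) (card A - 1) = (\<Sum>c\<in>A. s c)"
  using assms
proof (induction A rule: finite_ne_induct)
  case (insert x F)
  have d: "degree (\<Prod>c\<in>F. [:s c, 1:]) = card F"
    by (subst degree_prod_eq_sum_degree) auto
  have "lead_coeff (\<Prod>c\<in>F. [:s c, 1:]) = 1" by (simp add: lead_coeff_prod)
  then have l: "coeff (\<Prod>c\<in>F. [:s c, 1:]) (card F) = 1" by (simp add: d)
  obtain k where "card F = Suc k" using insert by (metis card_0_eq not0_implies_Suc)
  then show ?case using insert l by simp
qed simp

text \<open>
  The polynomial \<open>q = \<Prod>\<^sub>c (X + h - c) - \<Prod>\<^sub>c (X - c)\<close> takes the value \<open>h \<Prod>\<^bsub>c \<noteq> a\<^esub> (a - c + h)\<close> at \<open>a\<close>. So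
  \<open>h\<close> times the left-hand side is the sum of Lagrange quotients of \<open>q\<close>, whose value is the
  coefficient \<open>h |A|\<close> of \<open>q\<close> in degree \<open>|A| - 1\<close>.
\<close>

lemma sum_shift_ratios:
  fixes A :: "'a :: field set"
  assumes fin: "finite A" and h: "h \<noteq> 0"
  shows "(\<Sum>a\<in>A. \<Prod>c\<in>A - {a}. (a - c + h) / (a - c)) = of_nat (card A)"
proof (cases "A = {}")
  case False
  define q where "q = (\<Prod>c\<in>A. [:h - c, 1:]) - (\<Prod>c\<in>A. [:- c, 1:])"
  have n: "card A > 0" using False fin by (simp add: card_gt_0_iff)
  have mon: "degree (\<Prod>c\<in>A. [:s c, 1:]) = card A" "lead_coeff (\<Prod>c\<in>A. [:s c, 1:]) = 1"
    for s :: "'a \<Rightarrow> 'a"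
    using fin by (subst degree_prod_eq_sum_degree, auto simp: lead_coeff_prod)
  have "degree q < card A"
  proof -
    have "degree q \<le> card A"
      unfolding q_def by (intro degree_diff_le) (simp_all add: mon)
    moreover have "coeff q (card A) = 0"
      using mon(2)[of "\<lambda>c. h - c"] mon(2)[of "\<lambda>c. - c"] by (simp add: q_def mon(1))
    ultimately show ?thesis
      using n by (metis degree_0 leading_coeff_0_iff le_neq_implies_less)
  qed
  then have "(\<Sum>a\<in>A. poly q a / (\<Prod>c\<in>A - {a}. a - c)) = coeff q (card A - 1)"
    by (rule sum_lagrange_quotients[OF fin])
  also have "\<dots> = h * of_nat (card A)"
    unfolding q_def coeff_diff coeff_prod_linear_pred_card[OF fin False]
    by (simp add: sum_subtractf sum_negf mult.commute)
  also have "(\<Sum>a\<in>A. poly q a / (\<Prod>c\<in>A - {a}. a - c)) =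
      h * (\<Sum>a\<in>A. \<Prod>c\<in>A - {a}. (a - c + h) / (a - c))"
    unfolding sum_distrib_left
  proof (rule sum.cong[OF refl])
    fix a assume a: "a \<in> A"
    have "(\<Prod>c\<in>A. a - c) = 0" using a fin by (intro prod_zero) auto
    then have "poly q a = (\<Prod>c\<in>A. a - c + h)" by (simp add: q_def poly_prod algebra_simps)
    also have "\<dots> = h * (\<Prod>c\<in>A - {a}. a - c + h)" using a fin by (simp add: prod.remove)
    finally show "poly q a / (\<Prod>c\<in>A - {a}. a - c) = h * (\<Prod>c\<in>A - {a}. (a - c + h) / (a - c))"
      by (simp add: prod_dividef)
  qed
  finally show ?thesis using h by simp
qed simp

section \<open>From orderings to subsets\<close>

text \<open>
  The summand of a permutation, computed on the list of the permuted variables: \<open>f\<close> on the first \<open>p\<close>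
  entries, \<open>g\<close> on the others, and \<open>w\<close> on all pairs in their order. Reading the list from the head
  allows an induction that removes the first variable.
\<close>

fun ord_weight :: "('a \<Rightarrow> 'b) \<Rightarrow> ('a \<Rightarrow> 'b) \<Rightarrow> ('a \<Rightarrow> 'a \<Rightarrow> 'b) \<Rightarrow> nat \<Rightarrow> 'a list \<Rightarrow> 'b :: comm_ring_1"
  where
    "ord_weight f g w p [] = 1"
  | "ord_weight f g w p (a # as) =
      (if p = 0 then g a else f a) * (\<Prod>c\<in>set as. w a c) * ord_weight f g w (p - 1) as"

text \<open>
  What remains of the weight of an ordering that begins with the elements of \<open>I\<close> when the factors
  \<open>w\<close> within \<open>I\<close> and within \<open>A - I\<close> are dropped.
\<close>

definition cut_weight :: "('a \<Rightarrow> 'b) \<Rightarrow> ('a \<Rightarrow> 'b) \<Rightarrow> ('a \<Rightarrow> 'a \<Rightarrow> 'b) \<Rightarrow> 'a set \<Rightarrow> 'a set \<Rightarrow> 'b :: comm_ring_1"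
  where "cut_weight f g w A I =
    (\<Prod>a\<in>I. f a) * (\<Prod>a\<in>A - I. g a) * (\<Prod>a\<in>I. \<Prod>c\<in>A - I. w a c)"

lemma sum_permutations_of_set_Cons:
  assumes "finite A" "A \<noteq> {}"
  shows "(\<Sum>xs\<in>permutations_of_set A. F xs) =
    (\<Sum>a\<in>A. \<Sum>as\<in>permutations_of_set (A - {a}). F (a # as))"
  unfolding permutations_of_set_nonempty[OF assms(2)]
  by (subst sum.UNION_disjoint) (auto simp: assms(1) sum.reindex)

text \<open>
  Induction on \<open>A\<close>, by the choice of the first element \<open>a\<close> of the ordering. For \<open>p > 0\<close> the rest of
  the ordering has an initial set \<open>J\<close>. With \<open>I = J \<union> {a}\<close>, the weight of the cut of \<open>A - {a}\<close> at \<open>J\<close>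
  becomes that of the cut of \<open>A\<close> at \<open>I\<close>, with the factor \<open>\<Prod>\<^bsub>c \<in> I - {a}\<^esub> w(a,c)\<close> left over. By the
  hypothesis on \<open>w\<close>, summing this over the possible \<open>a \<in> I\<close> gives \<open>|I| = p\<close>. For \<open>p = 0\<close> the
  same hypothesis is used with \<open>A\<close> instead of \<open>I\<close>.
\<close>

lemma sum_ord_weight:
  fixes w :: "'a \<Rightarrow> 'a \<Rightarrow> 'b :: comm_ring_1"
  assumes "finite A" and "p \<le> card A"
    and "\<And>B. B \<subseteq> A \<Longrightarrow> (\<Sum>a\<in>B. \<Prod>c\<in>B - {a}. w a c) = of_nat (card B)"
  shows "(\<Sum>as\<in>permutations_of_set A. ord_weight f g w p as) =
    of_nat (fact p * fact (card A - p)) * (\<Sum>I | I \<subseteq> A \<and> card I = p. cut_weight f g w A I)"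
  using assms
proof (induction "card A" arbitrary: A p)
  case 0
  then have "A = {}" "p = 0" by auto
  moreover have "{I. I \<subseteq> ({} :: 'a set) \<and> card I = 0} = {{}}" by auto
  ultimately show ?case by (simp add: cut_weight_def)
next
  case (Suc n)
  note fin = \<open>finite A\<close>
  have w: "(\<Sum>a\<in>B. \<Prod>c\<in>B - {a}. w a c) = of_nat (card B)" if "B \<subseteq> A" for B
    using Suc.prems(3) that .
  have ne: "A \<noteq> {}" using Suc by auto
  have IH: "(\<Sum>as\<in>permutations_of_set (A - {a}). ord_weight f g w k as) =
      of_nat (fact k * fact (n - k)) * (\<Sum>I | I \<subseteq> A - {a} \<and> card I = k. cut_weight f g w (A - {a}) I)"
    if "a \<in> A" "k \<le> n" for a k
  proof -
    have "n = card (A - {a})" using Suc(2) that fin by simp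
    then show ?thesis using Suc(1)[of "A - {a}" k] that fin w by (metis Diff_subset finite_Diff subset_trans)
  qed
  have step: "(\<Sum>as\<in>permutations_of_set A. ord_weight f g w p as) =
      (\<Sum>a\<in>A. (if p = 0 then g a else f a) * (\<Prod>c\<in>A - {a}. w a c) *
        (\<Sum>as\<in>permutations_of_set (A - {a}). ord_weight f g w (p - 1) as))"
    unfolding sum_permutations_of_set_Cons[OF fin ne] sum_distrib_left
    by (intro sum.cong refl) (simp add: permutations_of_setD)
  show ?case
  proof (cases p)
    case 0
    have e: "{I. I \<subseteq> B \<and> card I = 0} = {{}}" if "finite B" for B :: "'a set"
      using that by (auto dest: finite_subset)
    have "(\<Sum>as\<in>permutations_of_set A. ord_weight f g w p as) =
        (\<Sum>a\<in>A. g a * (\<Prod>c\<in>A - {a}. w a c) * (of_nat (fact n) * (\<Prod>a\<in>A - {a}. g a)))"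
      unfolding step using 0 fin by (intro sum.cong refl) (simp add: IH e cut_weight_def)
    also have "\<dots> = (\<Sum>a\<in>A. of_nat (fact n) * (\<Prod>a\<in>A. g a) * (\<Prod>c\<in>A - {a}. w a c))"
      using fin by (intro sum.cong refl) (simp add: prod.remove mult_ac)
    also have "\<dots> = of_nat (fact n) * (\<Prod>a\<in>A. g a) * of_nat (card A)"
      by (simp add: w flip: sum_distrib_left)
    finally show ?thesis using 0 fin Suc(2)[symmetric] by (simp add: e cut_weight_def algebra_simps)
  next
    case (Suc k)
    then have k: "k \<le> n" using Suc.prems(2) \<open>Suc n = card A\<close> by simp
    have "(\<Sum>as\<in>permutations_of_set A. ord_weight f g w p as) =
        (\<Sum>a\<in>A. \<Sum>J | J \<subseteq> A - {a} \<and> card J = k. of_nat (fact k * fact (n - k)) *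
          (f a * (\<Prod>c\<in>A - {a}. w a c) * cut_weight f g w (A - {a}) J))"
      unfolding step using Suc fin k
      by (intro sum.cong refl) (simp add: IH sum_distrib_left mult_ac)
    also have "\<dots> = (\<Sum>a\<in>A. \<Sum>J | J \<subseteq> A - {a} \<and> card J = k. of_nat (fact k * fact (n - k)) *
          ((\<Prod>c\<in>insert a J - {a}. w a c) * cut_weight f g w A (insert a J)))"
    proof (intro sum.cong refl)
      fix a J assume a: "a \<in> A" and "J \<in> {J. J \<subseteq> A - {a} \<and> card J = k}"
      then have J: "J \<subseteq> A - {a}" "finite J" "a \<notin> J" using fin by (auto dest: finite_subset)
      have "A - {a} - J = A - insert a J" "insert a J - {a} = J" using J by auto
      moreover have "(\<Prod>c\<in>A - {a}. w a c) = (\<Prod>c\<in>A - {a} - J. w a c) * (\<Prod>c\<in>J. w a c)"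
        by (rule prod.subset_diff) (use J fin in auto)
      ultimately show "of_nat (fact k * fact (n - k)) * (f a * (\<Prod>c\<in>A - {a}. w a c) * cut_weight f g w (A - {a}) J) =
          of_nat (fact k * fact (n - k)) * ((\<Prod>c\<in>insert a J - {a}. w a c) * cut_weight f g w A (insert a J))"
        using J by (simp add: cut_weight_def mult_ac)
    qed
    also have "\<dots> = (\<Sum>(a, J)\<in>(SIGMA a:A. {J. J \<subseteq> A - {a} \<and> card J = k}). of_nat (fact k * fact (n - k)) *
          ((\<Prod>c\<in>insert a J - {a}. w a c) * cut_weight f g w A (insert a J)))"
      using fin by (intro sum.Sigma) auto
    also have "\<dots> = (\<Sum>(I, a)\<in>(SIGMA I:{I. I \<subseteq> A \<and> card I = Suc k}. I). of_nat (fact k * fact (n - k)) *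
          ((\<Prod>c\<in>I - {a}. w a c) * cut_weight f g w A I))"
      by (rule sum.reindex_bij_witness[where i = "\<lambda>(I, a). (a, I - {a})" and j = "\<lambda>(a, J). (insert a J, a)"])
        (use fin in \<open>auto simp: card_insert_if finite_subset insert_absorb\<close>)
    also have "\<dots> = (\<Sum>I | I \<subseteq> A \<and> card I = Suc k. \<Sum>a\<in>I. of_nat (fact k * fact (n - k)) *
          ((\<Prod>c\<in>I - {a}. w a c) * cut_weight f g w A I))"
      using fin by (intro sum.Sigma[symmetric]) (auto dest: finite_subset)
    also have "\<dots> = (\<Sum>I | I \<subseteq> A \<and> card I = Suc k. of_nat (fact (Suc k) * fact (n - k)) * cut_weight f g w A I)"
    proof (intro sum.cong refl)
      fix I assume "I \<in> {I. I \<subseteq> A \<and> card I = Suc k}"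
      then have I: "I \<subseteq> A" "card I = Suc k" by auto
      have "(\<Sum>a\<in>I. of_nat (fact k * fact (n - k)) * ((\<Prod>c\<in>I - {a}. w a c) * cut_weight f g w A I)) =
          of_nat (fact k * fact (n - k)) * ((\<Sum>a\<in>I. \<Prod>c\<in>I - {a}. w a c) * cut_weight f g w A I)"
        by (simp add: sum_distrib_left sum_distrib_right mult_ac)
      then show "(\<Sum>a\<in>I. of_nat (fact k * fact (n - k)) * ((\<Prod>c\<in>I - {a}. w a c) * cut_weight f g w A I)) =
          of_nat (fact (Suc k) * fact (n - k)) * cut_weight f g w A I"
        by (simp only: w[OF I(1)] I(2)) (simp add: algebra_simps)
    qed
    finally show ?thesis using Suc \<open>Suc n = card A\<close>[symmetric] by (simp add: sum_distrib_left)
  qed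
qed

text \<open>
  The count of remaining \<open>f\<close>-entries is written as \<open>q - m\<close>, so that the split at the fixed index \<open>q\<close>
  survives an induction that lets \<open>m\<close> decrease.
\<close>

lemma ord_weight_map_upt:
  assumes "m \<le> k" and "inj_on u {m..<k}"
  shows "ord_weight f g w (q - m) (map u [m..<k]) =
    (\<Prod>i\<in>{m..<k}. if i < q then f (u i) else g (u i)) *
    (\<Prod>i\<in>{m..<k}. \<Prod>j\<in>{i<..<k}. w (u i) (u j))"
  using assms
proof (induction m rule: inc_induct)
  case (step m)
  have s: "{m..<k} = insert m {Suc m..<k}" "[m..<k] = m # [Suc m..<k]" "{m<..<k} = {Suc m..<k}"
    using step.hyps by (auto simp: upt_conv_Cons)
  have inj: "inj_on u {Suc m..<k}" using step.prems s by (auto intro: inj_on_subset)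
  have "(\<Prod>c\<in>u ` {Suc m..<k}. w (u m) c) = (\<Prod>j\<in>{m<..<k}. w (u m) (u j))"
    using inj by (simp add: prod.reindex s)
  then show ?case
    using step.IH[OF inj] unfolding s(1,2) by (auto simp: mult_ac)
qed simp

text \<open>
  The lists are injective in \<open>\<sigma>\<close>, and both sides have \<open>n!\<close> elements.
\<close>

lemma bij_betw_permutes_lists:
  assumes inj: "inj_on x {1..n}"
  shows "bij_betw (\<lambda>\<sigma>. map (\<lambda>i. x (\<sigma> i)) [1..<Suc n]) {\<sigma>. \<sigma> permutes {1..n}}
    (permutations_of_set (x ` {1..n}))"
proof -
  let ?m = "\<lambda>\<sigma>. map (\<lambda>i. x (\<sigma> i)) [1..<Suc n]" and ?S = "{\<sigma>. \<sigma> permutes {1..n}}"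
  have set: "set [1..<Suc n] = {1..n}" by auto
  have "inj_on ?m ?S"
  proof (rule inj_onI)
    fix \<sigma> \<tau> assume s: "\<sigma> \<in> ?S" "\<tau> \<in> ?S" and eq: "?m \<sigma> = ?m \<tau>"
    show "\<sigma> = \<tau>"
    proof
      fix i
      show "\<sigma> i = \<tau> i"
      proof (cases "i \<in> {1..n}")
        case True
        then have "x (\<sigma> i) = x (\<tau> i)" using eq set by (simp only: map_eq_conv)
        moreover have "\<sigma> i \<in> {1..n}" "\<tau> i \<in> {1..n}"
          using s True by (simp_all only: mem_Collect_eq permutes_in_image)
        ultimately show ?thesis using inj by (meson inj_onD)
      next
        case False
        then show ?thesis using s by (simp add: permutes_not_in)
      qed
    qed
  qed
  moreover have "?m ` ?S \<subseteq> permutations_of_set (x ` {1..n})"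
  proof safe
    fix \<sigma> assume s: "\<sigma> permutes {1..n}"
    show "?m \<sigma> \<in> permutations_of_set (x ` {1..n})"
    proof
      show "set (?m \<sigma>) = x ` {1..n}"
        unfolding set_map set using permutes_image[OF s] by (metis image_image)
      have "inj_on (\<lambda>i. x (\<sigma> i)) {1..n}"
        using inj permutes_image[OF s] permutes_inj_on[OF s]
        by (metis comp_inj_on_iff[unfolded o_def])
      then show "distinct (?m \<sigma>)" unfolding distinct_map set by simp
    qed
  qed
  moreover have "card ?S = card (permutations_of_set (x ` {1..n}))"
    using inj by (simp add: card_permutations card_image)
  ultimately show ?thesis
    by (metis bij_betw_imageI card_image card_subset_eq finite_permutations_of_set)
qed

section \<open>The symmetrized sum over a field\<close>

lemma prod_pairs_minus_one:
  "(\<Prod>i\<in>{1..<Suc n}. \<Prod>j\<in>{i<..<Suc n}. - 1 :: 'a :: comm_ring_1) = (-1) ^ (n choose 2)"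
proof -
  have "(\<Prod>i\<in>{1..<Suc n}. (-1 :: 'a) ^ (n - i)) = (-1) ^ (n choose 2)"
  proof (induction n)
    case (Suc n)
    have "(\<Prod>i\<in>{1..<Suc (Suc n)}. (-1 :: 'a) ^ (Suc n - i)) = (\<Prod>i\<in>{1..<Suc n}. - 1 * (-1) ^ (n - i))"
      by (auto simp: Suc_diff_le intro!: prod.cong)
    also have "\<dots> = (-1) ^ n * (-1) ^ (n choose 2)"
      by (simp only: prod.distrib Suc) simp
    also have "\<dots> = (-1) ^ (Suc n choose 2)"
      by (simp add: power_add numeral_2_eq_2)
    finally show ?case .
  qed (simp add: numeral_2_eq_2)
  then show ?thesis by (simp del: One_nat_def)
qed

lemma summand_eq_ord_weight:
  fixes u :: "nat \<Rightarrow> 'a :: field"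
  assumes inj: "inj_on u {1..n}" and p: "p \<le> n"
  shows "(-1) ^ p * (\<Prod>i=1..p. u i - \<beta>) * (\<Prod>j=p+1..n. u j + \<beta>) *
      (\<Prod>(i, j)\<in>{(i, j). 1 \<le> i \<and> i < j \<and> j \<le> n}. (u i - u j + h) / (u j - u i)) =
    (-1) ^ (n choose 2) * ord_weight (\<lambda>a. - (a - \<beta>)) (\<lambda>a. a + \<beta>) (\<lambda>a c. (a - c + h) / (a - c)) p
      (map u [1..<Suc n])"
proof -
  let ?w = "\<lambda>a c. (a - c + h) / (a - c)"
  have "(\<Prod>(i, j)\<in>{(i, j). 1 \<le> i \<and> i < j \<and> j \<le> n}. (u i - u j + h) / (u j - u i)) =
      (\<Prod>(i, j)\<in>(SIGMA i:{1..<Suc n}. {i<..<Suc n}). - 1 * ?w (u i) (u j))"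
  proof (rule prod.cong)
    show "{(i, j). 1 \<le> i \<and> i < j \<and> j \<le> n} = (SIGMA i:{1..<Suc n}. {i<..<Suc n})" by auto
    have "(u i - u j + h) / (u j - u i) = - 1 * ?w (u i) (u j)" for i j
      by (metis minus_diff_eq minus_divide_right mult_minus1)
    then show "(case z of (i, j) \<Rightarrow> (u i - u j + h) / (u j - u i)) =
        (case z of (i, j) \<Rightarrow> - 1 * ?w (u i) (u j))" for z :: "nat \<times> nat"
      by (simp only: split: prod.split)
  qed
  also have "\<dots> = (\<Prod>i\<in>{1..<Suc n}. \<Prod>j\<in>{i<..<Suc n}. - 1 * ?w (u i) (u j))"
    by (rule prod.Sigma[symmetric]) auto
  also have "\<dots> = (-1) ^ (n choose 2) * (\<Prod>i\<in>{1..<Suc n}. \<Prod>j\<in>{i<..<Suc n}. ?w (u i) (u j))"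
    by (simp only: prod.distrib prod_pairs_minus_one)
  finally have pairs: "(\<Prod>(i, j)\<in>{(i, j). 1 \<le> i \<and> i < j \<and> j \<le> n}. (u i - u j + h) / (u j - u i)) =
      (-1) ^ (n choose 2) * (\<Prod>i\<in>{1..<Suc n}. \<Prod>j\<in>{i<..<Suc n}. ?w (u i) (u j))" .
  have "(\<Prod>i\<in>{1..<Suc n}. if i < Suc p then - (u i - \<beta>) else u i + \<beta>) =
      (\<Prod>i\<in>{1..p} \<union> {p+1..n}. if i < Suc p then - (u i - \<beta>) else u i + \<beta>)"
    using p by (intro prod.cong) auto
  also have "\<dots> = (\<Prod>i\<in>{1..p}. if i < Suc p then - (u i - \<beta>) else u i + \<beta>) *
      (\<Prod>i\<in>{p+1..n}. if i < Suc p then - (u i - \<beta>) else u i + \<beta>)"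
    by (rule prod.union_disjoint) auto
  also have "(\<Prod>i\<in>{1..p}. if i < Suc p then - (u i - \<beta>) else u i + \<beta>) =
      (\<Prod>i\<in>{1..p}. - 1 * (u i - \<beta>))"
    by (intro prod.cong) auto
  also have "\<dots> = (-1) ^ p * (\<Prod>i=1..p. u i - \<beta>)"
    by (simp only: prod.distrib) simp
  also have "(\<Prod>i\<in>{p+1..n}. if i < Suc p then - (u i - \<beta>) else u i + \<beta>) =
      (\<Prod>j=p+1..n. u j + \<beta>)"
    by (intro prod.cong) auto
  finally have fg: "(\<Prod>i\<in>{1..<Suc n}. if i < Suc p then - (u i - \<beta>) else u i + \<beta>) =
      (-1) ^ p * (\<Prod>i=1..p. u i - \<beta>) * (\<Prod>j=p+1..n. u j + \<beta>)" .
  have "{1..<Suc n} = {1..n}" by auto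
  then have "inj_on u {1..<Suc n}" using inj by simp
  then have "ord_weight (\<lambda>a. - (a - \<beta>)) (\<lambda>a. a + \<beta>) ?w (Suc p - 1) (map u [1..<Suc n]) =
      (-1) ^ p * (\<Prod>i=1..p. u i - \<beta>) * (\<Prod>j=p+1..n. u j + \<beta>) *
      (\<Prod>i\<in>{1..<Suc n}. \<Prod>j\<in>{i<..<Suc n}. ?w (u i) (u j))"
    unfolding fg[symmetric] by (intro ord_weight_map_upt) auto
  then show ?thesis by (simp only: pairs diff_Suc_1 mult_ac)
qed

lemma symmetrized_sum_eq:
  fixes x :: "nat \<Rightarrow> 'a :: field"
  assumes inj: "inj_on x {1..n}" and h: "h \<noteq> 0"
  shows "(\<Sum>\<sigma> | \<sigma> permutes {1..n}. \<Sum>p=0..n. (-1) ^ p * of_nat (n choose p) *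
      (\<Prod>i=1..p. x (\<sigma> i) - \<beta>) * (\<Prod>j=p+1..n. x (\<sigma> j) + \<beta>) *
      (\<Prod>(i, j)\<in>{(i, j). 1 \<le> i \<and> i < j \<and> j \<le> n}.
        (x (\<sigma> i) - x (\<sigma> j) + h) / (x (\<sigma> j) - x (\<sigma> i)))) =
    (-1) ^ (n choose 2) * of_nat (fact n) * (\<Prod>k<n. 2 * \<beta> - of_nat k * h)"
proof -
  let ?f = "\<lambda>a. - (a - \<beta>)" and ?g = "\<lambda>a. a + \<beta>" and ?w = "\<lambda>a c. (a - c + h) / (a - c)"
  define A where "A = x ` {1..n}"
  have fin: "finite A" and card: "card A = n" using inj by (simp_all add: A_def card_image)
  have injs: "inj_on (\<lambda>i. x (\<sigma> i)) {1..n}" if "\<sigma> permutes {1..n}" for \<sigma>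
    using inj permutes_image[OF that] permutes_inj_on[OF that]
    by (metis comp_inj_on_iff[unfolded o_def])
  have "(\<Sum>\<sigma> | \<sigma> permutes {1..n}. \<Sum>p=0..n. (-1) ^ p * of_nat (n choose p) *
      (\<Prod>i=1..p. x (\<sigma> i) - \<beta>) * (\<Prod>j=p+1..n. x (\<sigma> j) + \<beta>) *
      (\<Prod>(i, j)\<in>{(i, j). 1 \<le> i \<and> i < j \<and> j \<le> n}.
        (x (\<sigma> i) - x (\<sigma> j) + h) / (x (\<sigma> j) - x (\<sigma> i)))) =
    (\<Sum>\<sigma> | \<sigma> permutes {1..n}. \<Sum>p=0..n. of_nat (n choose p) * ((-1) ^ (n choose 2) *
      ord_weight ?f ?g ?w p (map (\<lambda>i. x (\<sigma> i)) [1..<Suc n])))"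
  proof (intro sum.cong refl)
    fix \<sigma> p assume "\<sigma> \<in> {\<sigma>. \<sigma> permutes {1..n}}" "p \<in> {0..n}"
    then have "inj_on (\<lambda>i. x (\<sigma> i)) {1..n}" "p \<le> n" using injs by simp_all
    from summand_eq_ord_weight[OF this, of \<beta> h, symmetric]
    show "(-1) ^ p * of_nat (n choose p) *
        (\<Prod>i=1..p. x (\<sigma> i) - \<beta>) * (\<Prod>j=p+1..n. x (\<sigma> j) + \<beta>) *
        (\<Prod>(i, j)\<in>{(i, j). 1 \<le> i \<and> i < j \<and> j \<le> n}.
          (x (\<sigma> i) - x (\<sigma> j) + h) / (x (\<sigma> j) - x (\<sigma> i))) =
      of_nat (n choose p) * ((-1) ^ (n choose 2) *
        ord_weight ?f ?g ?w p (map (\<lambda>i. x (\<sigma> i)) [1..<Suc n]))"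
      by (simp only: mult_ac)
  qed
  also have "\<dots> = (\<Sum>xs\<in>permutations_of_set A. \<Sum>p=0..n. of_nat (n choose p) * ((-1) ^ (n choose 2) *
      ord_weight ?f ?g ?w p xs))"
    unfolding A_def by (rule sum.reindex_bij_betw[OF bij_betw_permutes_lists[OF inj]])
  also have "\<dots> = (\<Sum>p=0..n. of_nat (n choose p) * ((-1) ^ (n choose 2) *
      (\<Sum>xs\<in>permutations_of_set A. ord_weight ?f ?g ?w p xs)))"
    by (subst sum.swap) (simp add: sum_distrib_left)
  also have "\<dots> = (\<Sum>p=0..n. (-1) ^ (n choose 2) * of_nat (fact n) *
      (\<Sum>I | I \<subseteq> A \<and> card I = p. cut_weight ?f ?g ?w A I))"
  proof (rule sum.cong[OF refl])
    fix p assume p: "p \<in> {0..n}"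
    have "(\<Sum>xs\<in>permutations_of_set A. ord_weight ?f ?g ?w p xs) =
        of_nat (fact p * fact (n - p)) * (\<Sum>I | I \<subseteq> A \<and> card I = p. cut_weight ?f ?g ?w A I)"
      using p by (subst sum_ord_weight) (auto simp: fin card h sum_shift_ratios finite_subset[OF _ fin])
    moreover have "of_nat (fact n) = (of_nat (n choose p) * of_nat (fact p * fact (n - p)) :: 'a)"
      using p binomial_fact_lemma[of p n] by (metis atLeastAtMost_iff mult.commute of_nat_mult)
    ultimately show "of_nat (n choose p) * ((-1) ^ (n choose 2) *
        (\<Sum>xs\<in>permutations_of_set A. ord_weight ?f ?g ?w p xs)) =
      (-1) ^ (n choose 2) * of_nat (fact n) * (\<Sum>I | I \<subseteq> A \<and> card I = p. cut_weight ?f ?g ?w A I)"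
      by (simp only: mult_ac)
  qed
  also have "\<dots> = (-1) ^ (n choose 2) * of_nat (fact n) *
      (\<Sum>p=0..n. \<Sum>I | I \<subseteq> A \<and> card I = p. cut_weight ?f ?g ?w A I)"
    by (simp add: sum_distrib_left)
  also have "(\<Sum>p=0..n. \<Sum>I | I \<subseteq> A \<and> card I = p. cut_weight ?f ?g ?w A I) =
      (\<Sum>I\<in>Pow A. cut_weight ?f ?g ?w A I)"
  proof -
    have "card ` Pow A \<subseteq> {0..n}" using fin card by (auto intro: card_mono)
    from sum.group[OF _ _ this] show ?thesis using fin by simp
  qed
  also have "\<dots> = (\<Prod>k<n. 2 * \<beta> - of_nat k * h)"
    unfolding cut_weight_def using subset_sum_eval[OF fin, of \<beta> h] by (simp add: card)
  finally show ?thesis .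
qed

section \<open>Constants and the permutation action\<close>

lemma bh_const_hom:
  "bh_const 0 = 0" "bh_const 1 = 1"
  "bh_const (c + d) = bh_const c + bh_const d"
  "bh_const (c * d) = bh_const c * bh_const d"
  "bh_const (- c) = - bh_const c"
  by (simp_all add: bh_const_def Zero_fract_def One_fract_def single_add mult_single single_uminus)

lemma bh_const_diff: "bh_const (c - d) = bh_const c - bh_const d"
  using bh_const_hom(3)[of c "- d"] bh_const_hom(5)[of d] by simp

lemma bh_const_of_nat: "bh_const (of_nat k) = of_nat k"
  by (induction k) (simp_all add: bh_const_hom)

lemma bh_const_power: "bh_const (c ^ k) = bh_const c ^ k"
  by (induction k) (simp_all add: bh_const_hom)

lemma bh_const_prod: "bh_const (\<Prod>a\<in>A. c a) = (\<Prod>a\<in>A. bh_const (c a))"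
  by (induction A rule: infinite_finite_induct) (simp_all add: bh_const_hom)

lemma bh_const_eq_0_iff: "bh_const c = 0 \<longleftrightarrow> c = 0"
proof
  assume "bh_const c = 0"
  then have "Poly_Mapping.single (0 :: nat \<Rightarrow>\<^sub>0 nat) c = 0"
    by (simp add: bh_const_def Zero_fract_def eq_fract)
  then show "c = 0" by (metis lookup_single_eq lookup_zero)
qed (simp add: bh_const_hom)

lemma perm_frac_sum:
  assumes "bij \<sigma>"
  shows "perm_frac \<sigma> (\<Sum>a\<in>A. F a) = (\<Sum>a\<in>A. perm_frac \<sigma> (F a))"
  using perm_frac_bh_const[OF assms, of 0]
  by (induction A rule: infinite_finite_induct) (simp_all add: bh_const_hom perm_frac_add assms)

lemma perm_frac_prod:
  assumes "bij \<sigma>"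
  shows "perm_frac \<sigma> (\<Prod>a\<in>A. F a) = (\<Prod>a\<in>A. perm_frac \<sigma> (F a))"
  using perm_frac_bh_const[OF assms, of 1]
  by (induction A rule: infinite_finite_induct) (simp_all add: bh_const_hom perm_frac_mult assms)

lemma perm_frac_diff: "bij \<sigma> \<Longrightarrow> perm_frac \<sigma> (x - y) = perm_frac \<sigma> x - perm_frac \<sigma> y"
  using perm_frac_add[of \<sigma> "x - y" y] by (simp add: algebra_simps)

lemma perm_frac_divide:
  assumes "bij \<sigma>"
  shows "perm_frac \<sigma> (x / y) = perm_frac \<sigma> x / perm_frac \<sigma> y"
proof (cases "y = 0")
  case True
  then show ?thesis using perm_frac_bh_const[OF assms, of 0] by (simp add: bh_const_hom)
next
  case False
  have "perm_frac \<sigma> y * perm_frac \<sigma> (1 / y) = perm_frac \<sigma> (bh_const 1)"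
    using False by (simp add: bh_const_hom flip: perm_frac_mult[OF assms])
  then have "perm_frac \<sigma> y \<noteq> 0" using assms by (auto simp: bh_const_eq_0_iff)
  moreover have "perm_frac \<sigma> x = perm_frac \<sigma> (x / y) * perm_frac \<sigma> y"
    using False by (simp flip: perm_frac_mult[OF assms])
  ultimately show ?thesis by simp
qed

lemma inj_lam: "inj lam"
proof (rule injI)
  fix i j assume "lam i = lam j"
  then have "Poly_Mapping.single (Poly_Mapping.single i (1 :: nat)) (1 :: bh_poly) =
      Poly_Mapping.single (Poly_Mapping.single j 1) 1"
    by (simp add: lam_def eq_fract)
  then have "Poly_Mapping.single i (1 :: nat) = Poly_Mapping.single j 1"
    by (metis lookup_single_eq lookup_single_not_eq one_neq_zero)
  then show "i = j"
    by (metis lookup_single_eq lookup_single_not_eq one_neq_zero)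
qed

section \<open>The closed form and the recursion\<close>

lemma S_sum_eq:
  "S_sum n = (-1) ^ (n choose 2) * of_nat (fact n) * (\<Prod>k<n. 2 * (bvar * hbar) - of_nat k * hbar)"
proof -
  have "hbar \<noteq> 0" by (simp add: hbar_def bh_const_eq_0_iff)
  moreover have "inj_on lam {1..n}" using inj_lam by (rule inj_on_subset) simp
  moreover have "perm_frac \<sigma> (\<Sum>p=0..n. (-1) ^ p * of_nat (n choose p) *
        (\<Prod>i=1..p. lam i - bvar * hbar) * (\<Prod>j=p+1..n. lam j + bvar * hbar) *
        (\<Prod>(i, j)\<in>{(i, j). 1 \<le> i \<and> i < j \<and> j \<le> n}. (lam i - lam j + hbar) / (lam j - lam i))) =
      (\<Sum>p=0..n. (-1) ^ p * of_nat (n choose p) *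
        (\<Prod>i=1..p. lam (\<sigma> i) - bvar * hbar) * (\<Prod>j=p+1..n. lam (\<sigma> j) + bvar * hbar) *
        (\<Prod>(i, j)\<in>{(i, j). 1 \<le> i \<and> i < j \<and> j \<le> n}.
          (lam (\<sigma> i) - lam (\<sigma> j) + hbar) / (lam (\<sigma> j) - lam (\<sigma> i))))"
    if "\<sigma> permutes {1..n}" for \<sigma>
  proof -
    have b: "bij \<sigma>" using that by (rule permutes_bij)
    have const: "perm_frac \<sigma> bvar = bvar" "perm_frac \<sigma> hbar = hbar"
        "perm_frac \<sigma> ((-1) ^ p * of_nat m) = (-1) ^ p * of_nat m" for p m
    proof -
      have "(-1) ^ p * of_nat m = bh_const ((-1) ^ p * of_nat m)"
        by (simp add: bh_const_hom bh_const_power bh_const_of_nat)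
      then show "perm_frac \<sigma> ((-1) ^ p * of_nat m) = (-1) ^ p * of_nat m"
        using b by simp
    qed (simp_all add: bvar_def hbar_def b)
    show ?thesis
      by (simp only: perm_frac_sum[OF b] perm_frac_prod[OF b] perm_frac_mult[OF b, of "_ * _"] const
            perm_frac_mult[OF b, of bvar] perm_frac_add[OF b] perm_frac_diff[OF b]
            perm_frac_divide[OF b] perm_frac_lam[OF b] case_prod_unfold)
  qed
  ultimately show ?thesis
    unfolding S_sum_def
    by (subst symmetrized_sum_eq[symmetric, of lam]) (auto intro!: sum.cong simp only:)
qed

theorem theoremA1:
  shows "(\<forall>n\<ge>1. S_sum n \<in> bh_ring) \<and>
    S_sum 1 = 2 * hbar * bvar \<and>
    (\<forall>n\<ge>2. S_sum n =
      S_sum (n - 1) * ((-1) ^ (n + 1) * 2 * hbar * of_nat n * (bvar - (of_nat n - 1) / 2)))"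
proof (intro conjI allI impI)
  fix n :: nat
  let ?B = "[:[:0, 1:]:] :: bh_poly" and ?H = "[:0, 1:] :: bh_poly"
  have "S_sum n = bh_const ((-1) ^ (n choose 2) * of_nat (fact n) *
      (\<Prod>k<n. of_nat 2 * (?B * ?H) - of_nat k * ?H))"
    unfolding bh_const_hom bh_const_power bh_const_prod bh_const_diff bh_const_of_nat
      S_sum_eq bvar_def hbar_def by simp
  then show "S_sum n \<in> bh_ring" by (simp add: bh_ring_def)
next
  show "S_sum 1 = 2 * hbar * bvar"
    by (simp add: S_sum_eq numeral_2_eq_2)
next
  fix n :: nat assume "n \<ge> 2"
  then obtain m where n: "n = Suc m" by (cases n) auto
  have "(2 :: lam_frac) \<noteq> 0"
    using bh_const_of_nat[of 2] bh_const_eq_0_iff[of "of_nat 2"] by simp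
  then have half: "2 * (bvar - of_nat m / 2) = 2 * bvar - of_nat m"
    by (simp add: field_simps)
  have "S_sum n = (-1) ^ m * of_nat n * (2 * (bvar * hbar) - of_nat m * hbar) * S_sum m"
    by (simp add: S_sum_eq n power_add numeral_2_eq_2 algebra_simps)
  also have "2 * (bvar * hbar) - of_nat m * hbar = hbar * (2 * (bvar - of_nat m / 2))"
    unfolding half by (simp add: algebra_simps)
  finally show "S_sum n = S_sum (n - 1) *
      ((-1) ^ (n + 1) * 2 * hbar * of_nat n * (bvar - (of_nat n - 1) / 2))"
    by (simp add: n mult_ac)
qed

end
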